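(* Let $X$ be a connected, compact, oriented smooth manifold, $\mathcal{E}$ a flat vector bundle over $X$ and $H$ an odd-degree closed form on $X$. Suppose $H=\sum_{i\ge1}H_{2i+1}$, where each $H_{2i+1}$ is a $(2i+1)$-form. For any $\lambda\in\mathbb{R}$, let $H^{(\lambda)}=\sum_{i\ge1}\lambda^iH_{2i+1}$. Then $H^\bullet(X,\mathcal{E},H)\cong H^\bullet(X,\mathcal{E},H^{(\lambda)})$ if $\lambda\ne0$.
   Context: A flat vector bundle $\mathcal{E}\to X$ is a real or complex vector bundle with a connection $\nabla^{\mathcal{E}}$ such that $(\nabla^{\mathcal{E}})^2=0$. $\Omega^{\bar0}(X,\mathcal{E})$ and $\Omega^{\bar1}(X,\mathcal{E})$ are the spaces of smooth even- and odd-degree $\mathcal{E}$-valued forms (bars denote integers modulo 2). For a (real) closed form $H$ with only odd-degree components, $\nabla^{\mathcal{E},H}=\nabla^{\mathcal{E}}+H\wedge\cdot$ squares to zero and exchanges $\Omega^{\bar0}(X,\mathcal{E})$ and $\Omega^{\bar1}(X,\mathcal{E})$; the twisted de Rham cohomology is $H^{\bar k}(X,\mathcal{E},H)=\ker(\nabla^{\mathcal{E},H}|_{\Omega^{\bar k}(X,\mathcal{E})})/\nabla^{\mathcal{E},H}(\Omega^{\overline{k+1}}(X,\mathcal{E}))$, $k=0,1$. The isomorphism is of $\mathbb{Z}_2$-graded vector spaces. *)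

theory Defs
  imports
    "HOL-Analysis.Analysis"
    "HOL-Library.Function_Algebras"
    "HOL-Library.Set_Algebras"
    "Jordan_Normal_Form.Determinant"
begin

section \<open>Smooth functions on open subsets of \<open>\<real>\<^sup>n\<close>\<close>

text \<open>
  \<open>\<real>\<^sup>n\<close> is the space \<open>Euclidean_space n\<close> of sequences vanishing from index \<open>n\<close> on, so that the
  dimension is a natural number and may be \<open>0\<close>.
\<close>

definition partial_deriv ::
  "nat \<Rightarrow> ((nat \<Rightarrow> real) \<Rightarrow> 'b::real_normed_vector) \<Rightarrow> (nat \<Rightarrow> real) \<Rightarrow> 'b" where
  "partial_deriv i f x = vector_derivative (\<lambda>t. f (x(i := t))) (at (x i))"

primrec Ck_on ::
  "nat \<Rightarrow> nat \<Rightarrow> (nat \<Rightarrow> real) set \<Rightarrow> ((nat \<Rightarrow> real) \<Rightarrow> 'b::real_normed_vector) \<Rightarrow> bool" where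
  "Ck_on n 0 S f = continuous_on S f"
| "Ck_on n (Suc k) S f =
    (continuous_on S f \<and>
     (\<forall>i<n. (\<forall>x\<in>S. (\<lambda>t. f (x(i := t))) differentiable (at (x i))) \<and>
            Ck_on n k S (partial_deriv i f)))"

definition Cinf_on ::
  "nat \<Rightarrow> (nat \<Rightarrow> real) set \<Rightarrow> ((nat \<Rightarrow> real) \<Rightarrow> 'b::real_normed_vector) \<Rightarrow> bool" where
  "Cinf_on n S f \<longleftrightarrow> (\<forall>k. Ck_on n k S f)"


section \<open>Oriented smooth manifolds\<close>

text \<open>The underlying space of the manifold is the whole type \<^typ>\<open>'a\<close>.\<close>

record 'a manifold =
  mdim :: nat
  charts :: "('a set \<times> ('a \<Rightarrow> nat \<Rightarrow> real)) set"

definition is_chart :: "nat \<Rightarrow> 'a::topological_space set \<times> ('a \<Rightarrow> nat \<Rightarrow> real) \<Rightarrow> bool" where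
  "is_chart n = (\<lambda>(U, \<phi>). open U \<and> openin (Euclidean_space n) (\<phi> ` U) \<and>
      (\<exists>g. homeomorphism U (\<phi> ` U) \<phi> g))"

definition smooth_manifold ::
  "'a::{t2_space, second_countable_topology} manifold \<Rightarrow> bool" where
  "smooth_manifold X \<longleftrightarrow>
     (\<forall>c\<in>charts X. is_chart (mdim X) c) \<and>
     (\<Union>(U, \<phi>)\<in>charts X. U) = UNIV \<and>
     (\<forall>(U, \<phi>)\<in>charts X. \<forall>(W, \<psi>)\<in>charts X. \<forall>i<mdim X.
        Cinf_on (mdim X) (\<phi> ` (U \<inter> W)) (\<lambda>y. \<psi> (inv_into U \<phi> y) i))"

text \<open>An orientation is given by an atlas whose transition maps have positive Jacobian.\<close>

definition oriented_manifold ::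
  "'a::{t2_space, second_countable_topology} manifold \<Rightarrow> bool" where
  "oriented_manifold X \<longleftrightarrow> smooth_manifold X \<and>
     (\<forall>(U, \<phi>)\<in>charts X. \<forall>(W, \<psi>)\<in>charts X. \<forall>y\<in>\<phi> ` (U \<inter> W).
        Determinant.det (Matrix.mat (mdim X) (mdim X)
          (\<lambda>(i, j). partial_deriv j (\<lambda>z. \<psi> (inv_into U \<phi> z) i) y)) > 0)"

definition smooth_on ::
  "'a manifold \<Rightarrow> 'a set \<Rightarrow> ('a \<Rightarrow> 'b::real_normed_vector) \<Rightarrow> bool" where
  "smooth_on X S f \<longleftrightarrow>
     (\<forall>(U, \<phi>)\<in>charts X. Cinf_on (mdim X) (\<phi> ` (U \<inter> S)) (\<lambda>y. f (inv_into U \<phi> y)))"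

definition smooth_funs :: "'a manifold \<Rightarrow> ('a \<Rightarrow> real) set" where
  "smooth_funs X = {f. smooth_on X UNIV f}"


section \<open>Tangent vectors and vector fields\<close>

text \<open>
  Tangent vectors at \<open>x\<close> are the derivations of the algebra of smooth functions at \<open>x\<close>; they are
  set to \<open>0\<close> on non-smooth functions so that equality of tangent vectors is equality of HOL
  functions.
\<close>

type_synonym 'a tvec = "('a \<Rightarrow> real) \<Rightarrow> real"
type_synonym 'a vfield = "'a \<Rightarrow> 'a tvec"

definition tangent_space :: "'a manifold \<Rightarrow> 'a \<Rightarrow> 'a tvec set" where
  "tangent_space X x = {v.
     (\<forall>f\<in>smooth_funs X. \<forall>g\<in>smooth_funs X.
        v (f + g) = v f + v g \<and> v (f * g) = f x * v g + g x * v f) \<and>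
     (\<forall>f\<in>smooth_funs X. \<forall>c. v (\<lambda>y. c * f y) = c * v f) \<and>
     (\<forall>f. f \<notin> smooth_funs X \<longrightarrow> v f = 0)}"

definition vector_fields :: "'a manifold \<Rightarrow> 'a vfield set" where
  "vector_fields X = {V. (\<forall>x. V x \<in> tangent_space X x) \<and>
     (\<forall>f\<in>smooth_funs X. (\<lambda>x. V x f) \<in> smooth_funs X)}"

definition lie_bracket :: "'a vfield \<Rightarrow> 'a vfield \<Rightarrow> 'a vfield" where
  "lie_bracket V W = (\<lambda>x f. V x (\<lambda>y. W y f) - W x (\<lambda>y. V y f))"


section \<open>Vector bundles and connections\<close>

text \<open>
  The scalar field \<^typ>\<open>'k::{real_normed_field, euclidean_space}\<close> is \<open>\<real>\<close> or \<open>\<complex>\<close>: these are the only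
  finite-dimensional real normed fields. The fibres are \<open>'k\<close>-subspaces of an ambient vector space
  \<^typ>\<open>'v\<close> that carries no topology; this is no restriction, since every family of
  vector spaces embeds into its direct sum. The smooth structure of the bundle is given by local
  trivialisations \<open>\<Phi> x\<close> from the fibre at \<open>x\<close> onto \<open>'k\<^sup>r\<close> with smooth transition matrices.
\<close>

record ('a, 'k, 'v) vbundle =
  brank :: nat
  scal :: "'k \<Rightarrow> 'v \<Rightarrow> 'v"
  fibre :: "'a \<Rightarrow> 'v set"
  trivs :: "('a set \<times> ('a \<Rightarrow> 'v \<Rightarrow> nat \<Rightarrow> 'k)) set"

definition coord_space :: "nat \<Rightarrow> (nat \<Rightarrow> 'k::zero) set" where
  "coord_space r = {c. \<forall>i\<ge>r. c i = 0}"

definition std_basis_vec :: "nat \<Rightarrow> nat \<Rightarrow> 'k::zero_neq_one" where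
  "std_basis_vec j = (\<lambda>i. if i = j then 1 else 0)"

definition is_triv ::
  "('a::topological_space, 'k::field, 'v::ab_group_add) vbundle \<Rightarrow>
   'a set \<times> ('a \<Rightarrow> 'v \<Rightarrow> nat \<Rightarrow> 'k) \<Rightarrow> bool" where
  "is_triv E = (\<lambda>(U, \<Phi>). open U \<and>
     (\<forall>x\<in>U. bij_betw (\<Phi> x) (fibre E x) (coord_space (brank E)) \<and>
        (\<forall>a\<in>fibre E x. \<forall>b\<in>fibre E x. \<Phi> x (a + b) = \<Phi> x a + \<Phi> x b) \<and>
        (\<forall>a\<in>fibre E x. \<forall>c. \<Phi> x (scal E c a) = (\<lambda>i. c * \<Phi> x a i))))"

definition vector_bundle ::
  "'a::topological_space manifold \<Rightarrow>
   ('a, 'k::{real_normed_field, euclidean_space}, 'v::real_vector) vbundle \<Rightarrow> bool" where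
  "vector_bundle X E \<longleftrightarrow>
     vector_space (scal E) \<and> (\<forall>c v. scal E (of_real c) v = c *\<^sub>R v) \<and>
     (\<forall>x. module.subspace (scal E) (fibre E x)) \<and>
     (\<forall>t\<in>trivs E. is_triv E t) \<and>
     (\<Union>(U, \<Phi>)\<in>trivs E. U) = UNIV \<and>
     (\<forall>(U, \<Phi>)\<in>trivs E. \<forall>(W, \<Psi>)\<in>trivs E. \<forall>i<brank E. \<forall>j<brank E.
        smooth_on X (U \<inter> W) (\<lambda>x. \<Psi> x (inv_into (fibre E x) (\<Phi> x) (std_basis_vec j)) i))"

definition sections ::
  "'a manifold \<Rightarrow> ('a, 'k::real_normed_vector, 'v) vbundle \<Rightarrow> ('a \<Rightarrow> 'v) set" where
  "sections X E = {s. (\<forall>x. s x \<in> fibre E x) \<and>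
     (\<forall>(U, \<Phi>)\<in>trivs E. \<forall>i<brank E. smooth_on X U (\<lambda>x. \<Phi> x (s x) i))}"

type_synonym ('a, 'v) conn = "'a vfield \<Rightarrow> ('a \<Rightarrow> 'v) \<Rightarrow> 'a \<Rightarrow> 'v"

definition connection ::
  "'a manifold \<Rightarrow> ('a, 'k::real_normed_vector, 'v::real_vector) vbundle \<Rightarrow> ('a, 'v) conn \<Rightarrow> bool" where
  "connection X E nab \<longleftrightarrow>
     (\<forall>V\<in>vector_fields X. \<forall>s\<in>sections X E.
        nab V s \<in> sections X E \<and>
        (\<forall>W\<in>vector_fields X. nab (V + W) s = nab V s + nab W s) \<and>
        (\<forall>t\<in>sections X E. nab V (s + t) = nab V s + nab V t) \<and>
        (\<forall>c. nab V (\<lambda>x. scal E c (s x)) = (\<lambda>x. scal E c (nab V s x))) \<and>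
        (\<forall>f\<in>smooth_funs X.
           nab (\<lambda>x g. f x * V x g) s = (\<lambda>x. f x *\<^sub>R nab V s x) \<and>
           nab V (\<lambda>x. f x *\<^sub>R s x) = (\<lambda>x. V x f *\<^sub>R s x + f x *\<^sub>R nab V s x)))"

text \<open>The trivial real line bundle; forms with values in it are the ordinary differential forms.\<close>

definition line_bundle :: "('a, real, real) vbundle" where
  "line_bundle = \<lparr>brank = 1, scal = (*), fibre = (\<lambda>x. UNIV),
     trivs = {(UNIV, \<lambda>x v i. if i = 0 then v else 0)}\<rparr>"

definition trivial_conn :: "('a, real) conn" where
  "trivial_conn V f = (\<lambda>x. V x f)"


section \<open>Bundle-valued differential forms\<close>

text \<open>
  An inhomogeneous form maps a point and a list of tangent vectors at that point to the fibre;
  its degree-\<open>p\<close> component is its restriction to lists of length \<open>p\<close>. Values on all other lists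
  are set to \<open>0\<close>.
\<close>

type_synonym ('a, 'v) form = "'a \<Rightarrow> 'a tvec list \<Rightarrow> 'v"

definition forms ::
  "'a manifold \<Rightarrow> ('a, 'k::real_normed_vector, 'v::real_vector) vbundle \<Rightarrow> nat \<Rightarrow> ('a, 'v) form set" where
  "forms X E p = {\<omega>.
     (\<forall>x vs. \<not> (length vs = p \<and> set vs \<subseteq> tangent_space X x) \<longrightarrow> \<omega> x vs = 0) \<and>
     (\<forall>x vs. length vs = p \<and> set vs \<subseteq> tangent_space X x \<longrightarrow>
        \<omega> x vs \<in> fibre E x \<and>
        (\<forall>i<p. \<forall>v\<in>tangent_space X x. \<forall>w\<in>tangent_space X x.
           \<omega> x (vs[i := v + w]) = \<omega> x (vs[i := v]) + \<omega> x (vs[i := w])) \<and>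
        (\<forall>i<p. \<forall>v\<in>tangent_space X x. \<forall>c.
           \<omega> x (vs[i := (\<lambda>f. c * v f)]) = c *\<^sub>R \<omega> x (vs[i := v])) \<and>
        (\<forall>j<p. \<forall>i<j. vs ! i = vs ! j \<longrightarrow> \<omega> x vs = 0)) \<and>
     (\<forall>Vs. length Vs = p \<and> set Vs \<subseteq> vector_fields X \<longrightarrow>
        (\<lambda>x. \<omega> x (map (\<lambda>V. V x) Vs)) \<in> sections X E)}"

definition form_component :: "nat \<Rightarrow> ('a, 'v::zero) form \<Rightarrow> ('a, 'v) form" where
  "form_component p \<omega> = (\<lambda>x vs. if length vs = p then \<omega> x vs else 0)"

text \<open>
  The even (\<open>k\<close> even) and odd (\<open>k\<close> odd) forms. All components in degrees above \<open>mdim X\<close> vanish,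
  hence no finiteness condition is needed for this to be the direct sum.
\<close>

definition parity_forms ::
  "'a manifold \<Rightarrow> ('a, 'k::real_normed_vector, 'v::real_vector) vbundle \<Rightarrow> nat \<Rightarrow> ('a, 'v) form set" where
  "parity_forms X E k = {\<omega>. \<forall>p. form_component p \<omega> \<in> forms X E p \<and>
     (p mod 2 \<noteq> k mod 2 \<longrightarrow> form_component p \<omega> = 0)}"

text \<open>
  Covariant exterior derivative on vector fields (Koszul formula):
  \<open>(\<nabla>\<omega>)(V\<^sub>0,\<dots>,V\<^sub>p) = \<Sum>\<^sub>i (-1)\<^sup>i \<nabla>\<^bsub>V\<^sub>i\<^esub> (\<omega>(\<dots> without V\<^sub>i \<dots>))
     + \<Sum>\<^bsub>i<j\<^esub> (-1)\<^bsup>i+j\<^esup> \<omega>([V\<^sub>i,V\<^sub>j], \<dots> without V\<^sub>i, V\<^sub>j \<dots>)\<close>.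
\<close>

definition koszul ::
  "('a, 'v::real_vector) conn \<Rightarrow> ('a, 'v) form \<Rightarrow> 'a vfield list \<Rightarrow> 'a \<Rightarrow> 'v" where
  "koszul nab \<omega> Vs x =
     (\<Sum>i<length Vs. (-1) ^ i *\<^sub>R
        nab (Vs ! i) (\<lambda>y. \<omega> y (map (\<lambda>V. V y) (nths Vs (- {i})))) x) +
     (\<Sum>j<length Vs. \<Sum>i<j. (-1) ^ (i + j) *\<^sub>R
        \<omega> x (map (\<lambda>V. V x) (lie_bracket (Vs ! i) (Vs ! j) # nths Vs (- {i, j}))))"

text \<open>
  The value of the Koszul formula at \<open>x\<close> depends only on the tangent vectors at \<open>x\<close>, so any
  extension of these to vector fields may be used; one exists for all tangent vectors at \<open>x\<close>.
\<close>

definition extends_to :: "'a manifold \<Rightarrow> 'a \<Rightarrow> 'a tvec list \<Rightarrow> 'a vfield list \<Rightarrow> bool" where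
  "extends_to X x vs Vs \<longleftrightarrow> set Vs \<subseteq> vector_fields X \<and> map (\<lambda>V. V x) Vs = vs"

definition ext_deriv ::
  "'a manifold \<Rightarrow> ('a, 'v::real_vector) conn \<Rightarrow> ('a, 'v) form \<Rightarrow> ('a, 'v) form" where
  "ext_deriv X nab \<omega> = (\<lambda>x vs.
     if \<exists>Vs. extends_to X x vs Vs then koszul nab \<omega> (SOME Vs. extends_to X x vs Vs) x else 0)"

definition flat_bundle ::
  "'a::topological_space manifold \<Rightarrow>
   ('a, 'k::{real_normed_field, euclidean_space}, 'v::real_vector) vbundle \<Rightarrow>
   ('a, 'v) conn \<Rightarrow> bool" where
  "flat_bundle X E nab \<longleftrightarrow> vector_bundle X E \<and> connection X E nab \<and>
     (\<forall>p. \<forall>\<omega>\<in>forms X E p. ext_deriv X nab (ext_deriv X nab \<omega>) = 0)"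

text \<open>
  Wedge product of a real form with a bundle-valued one, as a sum over shuffles: the set \<open>A\<close> of
  positions goes to the first factor, and the sign is that of the permutation moving the
  positions in \<open>A\<close> to the front. Summing over all \<open>A\<close> accounts for all degrees at once.
\<close>

definition shuffle_sign :: "nat set \<Rightarrow> real" where
  "shuffle_sign A = (-1) ^ card {(i, j). i < j \<and> i \<notin> A \<and> j \<in> A}"

definition wedge :: "('a, real) form \<Rightarrow> ('a, 'v::real_vector) form \<Rightarrow> ('a, 'v) form" where
  "wedge H \<omega> = (\<lambda>x vs. \<Sum>A\<in>Pow {..<length vs}.
     (shuffle_sign A * H x (nths vs A)) *\<^sub>R \<omega> x (nths vs (- A)))"


section \<open>Twisted de Rham cohomology\<close>

definition twisted_deriv ::
  "'a manifold \<Rightarrow> ('a, 'v::real_vector) conn \<Rightarrow> ('a, real) form \<Rightarrow> ('a, 'v) form \<Rightarrow> ('a, 'v) form" where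
  "twisted_deriv X nab H \<omega> = ext_deriv X nab \<omega> + wedge H \<omega>"

definition twisted_cocycles ::
  "'a manifold \<Rightarrow> ('a, 'k::real_normed_vector, 'v::real_vector) vbundle \<Rightarrow> ('a, 'v) conn \<Rightarrow>
   ('a, real) form \<Rightarrow> nat \<Rightarrow> ('a, 'v) form set" where
  "twisted_cocycles X E nab H k = {\<omega> \<in> parity_forms X E k. twisted_deriv X nab H \<omega> = 0}"

definition twisted_coboundaries ::
  "'a manifold \<Rightarrow> ('a, 'k::real_normed_vector, 'v::real_vector) vbundle \<Rightarrow> ('a, 'v) conn \<Rightarrow>
   ('a, real) form \<Rightarrow> nat \<Rightarrow> ('a, 'v) form set" where
  "twisted_coboundaries X E nab H k = twisted_deriv X nab H ` parity_forms X E (k + 1)"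

text \<open>
  The quotient space, as the set of cosets of the coboundaries. Addition of cosets is addition of
  sets; in \<open>coset_scale\<close> the subspace is added again so that multiplication by \<open>0\<close> gives the zero
  coset.
\<close>

definition twisted_cohomology ::
  "'a manifold \<Rightarrow> ('a, 'k::real_normed_vector, 'v::real_vector) vbundle \<Rightarrow> ('a, 'v) conn \<Rightarrow>
   ('a, real) form \<Rightarrow> nat \<Rightarrow> ('a, 'v) form set set" where
  "twisted_cohomology X E nab H k =
     (\<lambda>\<omega>. \<omega> +o twisted_coboundaries X E nab H k) ` twisted_cocycles X E nab H k"

definition coset_scale ::
  "('a, 'k, 'v::real_vector) vbundle \<Rightarrow> ('a, 'v) form set \<Rightarrow> 'k \<Rightarrow> ('a, 'v) form set \<Rightarrow>
   ('a, 'v) form set" where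
  "coset_scale E B c P = (\<lambda>\<omega> x vs. scal E c (\<omega> x vs)) ` P + B"

definition twisted_cohomology_iso ::
  "'a manifold \<Rightarrow> ('a, 'k::real_normed_vector, 'v::real_vector) vbundle \<Rightarrow> ('a, 'v) conn \<Rightarrow>
   ('a, real) form \<Rightarrow> ('a, real) form \<Rightarrow> nat \<Rightarrow>
   (('a, 'v) form set \<Rightarrow> ('a, 'v) form set) \<Rightarrow> bool" where
  "twisted_cohomology_iso X E nab H H' k F \<longleftrightarrow>
     bij_betw F (twisted_cohomology X E nab H k) (twisted_cohomology X E nab H' k) \<and>
     (\<forall>P\<in>twisted_cohomology X E nab H k. \<forall>Q\<in>twisted_cohomology X E nab H k.
        F (P + Q) = F P + F Q) \<and>
     (\<forall>P\<in>twisted_cohomology X E nab H k. \<forall>c.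
        F (coset_scale E (twisted_coboundaries X E nab H k) c P) =
        coset_scale E (twisted_coboundaries X E nab H' k) c (F P))"

definition twisted_cohomology_isomorphic ::
  "'a manifold \<Rightarrow> ('a, 'k::real_normed_vector, 'v::real_vector) vbundle \<Rightarrow> ('a, 'v) conn \<Rightarrow>
   ('a, real) form \<Rightarrow> ('a, real) form \<Rightarrow> bool" where
  "twisted_cohomology_isomorphic X E nab H H' \<longleftrightarrow>
     (\<forall>k\<in>{0, 1}. \<exists>F. twisted_cohomology_iso X E nab H H' k F)"

end

theory Submission
  imports Defs
begin

text \<open>
  Multiply the degree-\<open>p\<close> component of every form by a factor \<open>u p\<close> and write \<open>c\<^sub>u\<close> for this
  operation. The derivative \<open>d\<close> given by the connection raises degrees by \<open>1\<close> and
  \<open>H\<^sub>2\<^sub>i\<^sub>+\<^sub>1 \<and> _\<close> raises them by \<open>2i + 1\<close>. Write \<open>D\<close> and \<open>D'\<close> for the twisted derivatives of \<open>H\<close> and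
  of \<open>H' = \<Sum>\<^sub>i r\<^sup>i H\<^sub>2\<^sub>i\<^sub>+\<^sub>1\<close>. Then \<open>D' c\<^sub>u = c\<^sub>v D\<close> as soon as
  \<open>v (p + 1) = u p\<close> and \<open>v (p + 2i + 1) = r\<^sup>i u p\<close>, that is, as soon as \<open>v\<close> is the shift of \<open>u\<close> by
  one and \<open>u (p + 2) = r u p\<close>. The form \<open>H'\<close> is itself \<open>c\<^sub>w H\<close> with \<open>w p = r^(p div 2)\<close>, since
  \<open>(2i + 1) div 2 = i\<close>.

  The weight \<open>w\<close> fits on both sides of such a relation: \<open>D' c\<^sub>w = c\<^sub>v D\<close> for a weight \<open>v\<close>, and
  \<open>D' c\<^sub>u = c\<^sub>w D\<close> for the weight \<open>u p = r^((p + 1) div 2)\<close>. For \<open>r \<noteq> 0\<close> all these weights are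
  nonzero, so the rescalings are bijective. The first relation shows that \<open>c\<^sub>w\<close> maps
  cocycles onto cocycles, the second that it maps coboundaries onto coboundaries. As \<open>c\<^sub>w\<close> is
  linear, taking images under it is the required isomorphism.

  The relation \<open>D' c\<^sub>u = c\<^sub>v D\<close> is \<open>twisted_deriv_rescale\<close>, and the isomorphism is
  \<open>twisted_cohomology_iso_rescale\<close>. The connection is homogeneous only on smooth sections, and
  a rescaled form has to be smooth again; this is why smoothness is first shown to be stable under
  scaling.
\<close>

section \<open>Smoothness under scaling\<close>

text \<open>
  Partial derivatives move one coordinate while the others stay fixed. Along such a line a relatively
  open set contains a neighbourhood of each of its points, which makes the partial derivatives local
  on it.
\<close>

lemma eventually_fun_upd_mem:
  assumes S: "openin (Euclidean_space n) S" and x: "x \<in> S" and i: "i < n"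
  shows "eventually (\<lambda>t. x(i := t) \<in> S) (nhds (x i))"
proof -
  obtain T where T: "open T" "S = T \<inter> {x. \<forall>j\<ge>n. x j = 0}"
    using S unfolding Euclidean_space_def openin_subtopology euclidean_product_topology
      open_openin[symmetric] by blast
  have "continuous_on UNIV (\<lambda>t. x(i := t))"
  proof (rule continuous_on_coordinatewise_then_product)
    fix j show "continuous_on UNIV (\<lambda>t. (x(i := t)) j)" by (cases "j = i") auto
  qed
  then have op: "open ((\<lambda>t. x(i := t)) -` T)"
    using T(1) by (simp add: open_vimage)
  moreover have "x i \<in> (\<lambda>t. x(i := t)) -` T"
    using x T(2) by simp
  ultimately have "eventually (\<lambda>t. x(i := t) \<in> T) (nhds (x i))"
    using eventually_nhds by (metis (mono_tags, lifting) vimage_eq)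
  then show ?thesis
    by eventually_elim (use x T(2) i in auto)
qed

text \<open>
  Fibre coordinates and inverse charts have arbitrary values outside their domains, so the functions
  whose smoothness has to be compared agree only on the open set in question.
\<close>

lemma Ck_on_cong_imp:
  assumes S: "openin (Euclidean_space n) S"
  shows "(\<And>x. x \<in> S \<Longrightarrow> f x = g x) \<Longrightarrow> Ck_on n k S f \<Longrightarrow> Ck_on n k S g"
proof (induction k arbitrary: f g)
  case 0
  then show ?case by (metis Ck_on.simps(1) continuous_on_cong)
next
  case (Suc k)
  have ev: "eventually (\<lambda>t. f (x(i := t)) = g (x(i := t))) (nhds (x i))" if "x \<in> S" "i < n" for x i
    using eventually_fun_upd_mem[OF S that] by eventually_elim (rule Suc.prems(1))
  have "(\<lambda>t. g (x(i := t))) differentiable (at (x i))" if "x \<in> S" "i < n" for x i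
  proof -
    have "(\<lambda>t. f (x(i := t))) differentiable (at (x i))"
      using Suc.prems(2) that by auto
    then obtain D where "((\<lambda>t. f (x(i := t))) has_derivative D) (at (x i))"
      unfolding differentiable_def by blast
    then have "((\<lambda>t. g (x(i := t))) has_derivative D) (at (x i))"
      using has_derivative_transform_eventually[of _ D "x i" UNIV "\<lambda>t. g (x(i := t))"]
        ev[OF that] Suc.prems(1)[OF that(1)]
      by (auto simp: eventually_nhds_conv_at)
    then show ?thesis unfolding differentiable_def by blast
  qed
  moreover have "Ck_on n k S (partial_deriv i g)" if "i < n" for i
  proof (rule Suc.IH)
    show "Ck_on n k S (partial_deriv i f)" using Suc.prems(2) that by auto
    show "partial_deriv i f x = partial_deriv i g x" if "x \<in> S" for x
      unfolding partial_deriv_def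
      by (rule vector_derivative_cong_eq) (use ev[OF that \<open>i < n\<close>] in auto)
  qed
  ultimately show ?case
    using Suc.prems continuous_on_cong[of S S f g] by auto
qed

lemma Ck_on_scaleR:
  assumes S: "openin (Euclidean_space n) S"
  shows "Ck_on n k S f \<Longrightarrow> Ck_on n k S (\<lambda>x. a *\<^sub>R f x)"
proof (induction k arbitrary: f)
  case 0
  then show ?case by (auto intro!: continuous_intros)
next
  case (Suc k)
  have "partial_deriv i (\<lambda>x. a *\<^sub>R f x) x = a *\<^sub>R partial_deriv i f x" if "i < n" "x \<in> S" for i x
  proof -
    have "(\<lambda>t. f (x(i := t))) differentiable (at (x i))" using Suc.prems that by auto
    then have "((\<lambda>t. f (x(i := t))) has_vector_derivative partial_deriv i f x) (at (x i))"
      unfolding partial_deriv_def by (simp add: vector_derivative_works)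
    from bounded_linear.has_vector_derivative[OF bounded_linear_scaleR_right this]
    show ?thesis unfolding partial_deriv_def by (rule vector_derivative_at)
  qed
  then have "Ck_on n k S (partial_deriv i (\<lambda>x. a *\<^sub>R f x))" if "i < n" for i
    using Ck_on_cong_imp[OF S _ Suc.IH[of "partial_deriv i f"]] Suc.prems that by auto
  then show ?case
    using Suc.prems by (auto intro!: continuous_intros derivative_intros)
qed

lemma openin_chart_image:
  assumes "is_chart n (U, \<phi>)" "open W"
  shows "openin (Euclidean_space n) (\<phi> ` (U \<inter> W))"
proof -
  obtain g where h: "homeomorphism U (\<phi> ` U) \<phi> g"
    and op: "openin (Euclidean_space n) (\<phi> ` U)"
    using assms(1) by (auto simp: is_chart_def)
  have "openin (top_of_set (\<phi> ` U)) (\<phi> ` (U \<inter> W))"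
    using homeomorphism_imp_open_map[OF h] assms(2) by (simp add: openin_open_Int)
  moreover have "top_of_set (\<phi> ` U) = subtopology (Euclidean_space n) (\<phi> ` U)"
    using openin_subset[OF op]
    unfolding Euclidean_space_def euclidean_product_topology
    by (simp add: subtopology_subtopology Int_absorb1)
  ultimately show ?thesis
    using op openin_trans_full by metis
qed

text \<open>
  The two functions are related on \<open>W\<close> only, because a local trivialisation is linear only over its
  domain.
\<close>

lemma smooth_on_scaleR:
  assumes X: "smooth_manifold X" and W: "open W" and f: "smooth_on X W f"
    and eq: "\<And>x. x \<in> W \<Longrightarrow> g x = a *\<^sub>R f x"
  shows "smooth_on X W g"
  unfolding smooth_on_def
proof clarify
  fix U \<phi> assume c: "(U, \<phi>) \<in> charts X"
  then have ch: "is_chart (mdim X) (U, \<phi>)" using X by (auto simp: smooth_manifold_def)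
  have inj: "inj_on \<phi> U"
    using ch by (auto simp: is_chart_def homeomorphism_def intro: inj_on_inverseI)
  note S = openin_chart_image[OF ch W]
  have "Ck_on (mdim X) k (\<phi> ` (U \<inter> W)) (\<lambda>y. g (inv_into U \<phi> y))" for k
  proof (rule Ck_on_cong_imp[OF S])
    show "Ck_on (mdim X) k (\<phi> ` (U \<inter> W)) (\<lambda>y. a *\<^sub>R f (inv_into U \<phi> y))"
      using f c by (intro Ck_on_scaleR[OF S]) (auto simp: smooth_on_def Cinf_on_def)
  qed (use inj eq in auto)
  then show "Cinf_on (mdim X) (\<phi> ` (U \<inter> W)) (\<lambda>y. g (inv_into U \<phi> y))"
    by (simp add: Cinf_on_def)
qed

section \<open>Scaling sections and forms\<close>

lemma fibre_scaleR:
  assumes "vector_bundle X E" "v \<in> fibre E x"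
  shows "a *\<^sub>R v \<in> fibre E x"
proof -
  interpret vector_space "scal E" using assms(1) by (simp add: vector_bundle_def)
  have "scal E (of_real a) v \<in> fibre E x"
    using assms by (intro subspace_scale) (auto simp: vector_bundle_def)
  then show ?thesis using assms(1) by (simp add: vector_bundle_def)
qed

lemma sections_scaleR:
  assumes X: "smooth_manifold X" and E: "vector_bundle X E" and s: "s \<in> sections X E"
  shows "(\<lambda>x. a *\<^sub>R s x) \<in> sections X E"
proof -
  have "smooth_on X U (\<lambda>x. \<Phi> x (a *\<^sub>R s x) i)"
    if t: "(U, \<Phi>) \<in> trivs E" and i: "i < brank E" for U \<Phi> i
  proof (rule smooth_on_scaleR[OF X])
    have T: "is_triv E (U, \<Phi>)" using E t by (auto simp: vector_bundle_def)
    then show "open U" by (auto simp: is_triv_def)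
    show "smooth_on X U (\<lambda>x. \<Phi> x (s x) i)" using s t i by (auto simp: sections_def)
    fix x assume x: "x \<in> U"
    have "\<Phi> x (scal E (of_real a) (s x)) = (\<lambda>i. of_real a * \<Phi> x (s x) i)"
      using T x s by (auto simp: is_triv_def sections_def)
    then show "\<Phi> x (a *\<^sub>R s x) i = a *\<^sub>R \<Phi> x (s x) i"
      using E by (simp add: vector_bundle_def scaleR_conv_of_real)
  qed
  then show ?thesis
    using s fibre_scaleR[OF E] by (auto simp: sections_def)
qed

lemma forms_scaleR:
  assumes X: "smooth_manifold X" and E: "vector_bundle X E" and \<omega>: "\<omega> \<in> forms X E p"
  shows "(\<lambda>x vs. a *\<^sub>R \<omega> x vs) \<in> forms X E p"
proof -
  have "(\<lambda>x. a *\<^sub>R \<omega> x (map (\<lambda>V. V x) Vs)) \<in> sections X E"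
    if "length Vs = p" "set Vs \<subseteq> vector_fields X" for Vs
    using \<omega> that by (intro sections_scaleR[OF X E]) (auto simp: forms_def)
  moreover have "a *\<^sub>R \<omega> x vs \<in> fibre E x"
    if "length vs = p" "set vs \<subseteq> tangent_space X x" for x vs
    using \<omega> that by (intro fibre_scaleR[OF E]) (auto simp: forms_def)
  ultimately show ?thesis
    using \<omega> by (simp add: forms_def scaleR_right_distrib)
qed

definition rescale :: "(nat \<Rightarrow> real) \<Rightarrow> ('a, 'v::real_vector) form \<Rightarrow> ('a, 'v) form" where
  "rescale u \<omega> = (\<lambda>x vs. u (length vs) *\<^sub>R \<omega> x vs)"

lemma rescale_add: "rescale u (\<omega> + \<eta>) = rescale u \<omega> + rescale u \<eta>"
  by (simp add: rescale_def fun_eq_iff scaleR_right_distrib)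

lemma rescale_inverse:
  assumes "\<And>p. u p \<noteq> 0"
  shows "rescale u (rescale (\<lambda>p. inverse (u p)) \<omega>) = \<omega>"
    and "rescale (\<lambda>p. inverse (u p)) (rescale u \<omega>) = \<omega>"
  using assms by (simp_all add: rescale_def)

lemma inj_rescale: "(\<And>p. u p \<noteq> 0) \<Longrightarrow> inj (rescale u)"
  by (metis injI rescale_inverse(2))

lemma rescale_eq_0_iff: "(\<And>p. u p \<noteq> 0) \<Longrightarrow> rescale u \<omega> = 0 \<longleftrightarrow> \<omega> = 0"
  by (auto simp: rescale_def fun_eq_iff)

text \<open>
  Rescaling multiplies each homogeneous component by a constant, so it preserves the space of forms
  of given parity; the inverse weights give surjectivity.
\<close>

lemma rescale_image_parity_forms:
  assumes X: "smooth_manifold X" and E: "vector_bundle X E" and u: "\<And>p. u p \<noteq> 0"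
  shows "rescale u ` parity_forms X E k = parity_forms X E k"
proof -
  have sub: "rescale w \<omega> \<in> parity_forms X E k" if \<omega>: "\<omega> \<in> parity_forms X E k" for w \<omega>
  proof -
    have "form_component p (rescale w \<omega>) = (\<lambda>x vs. w p *\<^sub>R form_component p \<omega> x vs)" for p
      by (simp add: form_component_def rescale_def fun_eq_iff)
    moreover have "(\<lambda>x vs. w p *\<^sub>R form_component p \<omega> x vs) \<in> forms X E p" for p
      using \<omega> by (intro forms_scaleR[OF X E]) (auto simp: parity_forms_def)
    ultimately have "form_component p (rescale w \<omega>) \<in> forms X E p" for p
      by simp
    moreover have "form_component p (rescale w \<omega>) = 0" if "p mod 2 \<noteq> k mod 2" for p
    proof -
      have "form_component p \<omega> = 0" using \<omega> that by (auto simp: parity_forms_def)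
      then have "\<omega> x vs = 0" if "length vs = p" for x vs
        using that by (metis form_component_def zero_fun_apply)
      then show ?thesis by (simp add: form_component_def rescale_def fun_eq_iff)
    qed
    ultimately show ?thesis
      by (simp add: parity_forms_def)
  qed
  show ?thesis
  proof
    show "rescale u ` parity_forms X E k \<subseteq> parity_forms X E k" using sub by auto
    show "parity_forms X E k \<subseteq> rescale u ` parity_forms X E k"
      using sub rescale_inverse(1)[of u, OF u] by (metis image_eqI subsetI)
  qed
qed

section \<open>Rescaling and the twisted differential\<close>

lemma length_nths_add_compl:
  "length (nths vs A) + length (nths vs (- A)) = length vs"
proof -
  have "card {i. i < length vs \<and> i \<in> A} + card {i. i < length vs \<and> i \<notin> A}
      = card ({i. i < length vs \<and> i \<in> A} \<union> {i. i < length vs \<and> i \<notin> A})"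
    by (rule card_Un_disjoint[symmetric]) auto
  also have "{i. i < length vs \<and> i \<in> A} \<union> {i. i < length vs \<and> i \<notin> A} = {..<length vs}" by auto
  finally show ?thesis by (simp add: length_nths)
qed

lemma length_nths_compl:
  assumes "A \<subseteq> {..<length vs}"
  shows "length (nths vs (- A)) = length vs - card A"
proof -
  have "{i. i < length vs \<and> i \<in> A} = A" using assms by auto
  then show ?thesis
    using length_nths_add_compl[of vs A] by (simp add: length_nths)
qed

lemma connection_scal:
  assumes "connection X E nab" "V \<in> vector_fields X" "s \<in> sections X E"
  shows "nab V (\<lambda>x. scal E c (s x)) = (\<lambda>x. scal E c (nab V s x))"
proof -
  have "\<forall>c. nab V (\<lambda>x. scal E c (s x)) = (\<lambda>x. scal E c (nab V s x))"
    using assms unfolding connection_def by meson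
  then show ?thesis ..
qed

text \<open>
  On \<open>p + 1\<close> vector fields, every term of the Koszul formula contains the value of \<open>\<omega>\<close> on exactly \<open>p\<close>
  arguments: a derivative term leaves out one field, and a bracket term replaces two fields by one.
  So the common factor \<open>u p\<close> comes out. On no vector fields the formula is an empty sum,
  so the equation holds in degree \<open>0\<close> for any value of \<open>v 0\<close>.
\<close>

lemma ext_deriv_rescale:
  assumes E: "vector_bundle X E" and nab: "connection X E nab"
    and \<omega>: "\<omega> \<in> parity_forms X E k" and v: "\<And>p. v (Suc p) = u p"
  shows "ext_deriv X nab (rescale u \<omega>) = rescale v (ext_deriv X nab \<omega>)"
proof -
  have key: "koszul nab (rescale u \<omega>) Vs x = v (length Vs) *\<^sub>R koszul nab \<omega> Vs x"
    if Vs: "set Vs \<subseteq> vector_fields X" for Vs x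
  proof (cases "length Vs")
    case 0
    then show ?thesis by (simp add: koszul_def)
  next
    case (Suc p)
    have vu: "v (length Vs) = u p" using Suc v by simp
    have 1: "nab (Vs ! i) (\<lambda>y. rescale u \<omega> y (map (\<lambda>V. V y) (nths Vs (- {i})))) x
       = u p *\<^sub>R nab (Vs ! i) (\<lambda>y. \<omega> y (map (\<lambda>V. V y) (nths Vs (- {i})))) x"
      if i: "i < length Vs" for i
    proof -
      let ?s = "\<lambda>y. \<omega> y (map (\<lambda>V. V y) (nths Vs (- {i})))"
      have len: "length (nths Vs (- {i})) = p"
        using length_nths_compl[of "{i}" Vs] i Suc by simp
      have "form_component p \<omega> \<in> forms X E p" using \<omega> by (simp add: parity_forms_def)
      then have "(\<lambda>y. form_component p \<omega> y (map (\<lambda>V. V y) (nths Vs (- {i})))) \<in> sections X E"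
        using len Vs set_nths_subset[of Vs "- {i}"] by (auto simp: forms_def)
      then have s: "?s \<in> sections X E" using len by (simp add: form_component_def)
      have "Vs ! i \<in> vector_fields X" using Vs i by auto
      then have "nab (Vs ! i) (\<lambda>y. scal E (of_real (u p)) (?s y))
          = (\<lambda>y. scal E (of_real (u p)) (nab (Vs ! i) ?s y))"
        using connection_scal[OF nab _ s] by blast
      then show ?thesis
        using E len by (simp add: rescale_def vector_bundle_def)
    qed
    have 2: "rescale u \<omega> x (map (\<lambda>V. V x) (lie_bracket (Vs ! i) (Vs ! j) # nths Vs (- {i, j})))
       = u p *\<^sub>R \<omega> x (map (\<lambda>V. V x) (lie_bracket (Vs ! i) (Vs ! j) # nths Vs (- {i, j})))"
      if "j < length Vs" "i < j" for i j
      using length_nths_compl[of "{i, j}" Vs] that Suc by (simp add: rescale_def Suc_diff_Suc)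
    show ?thesis
      unfolding koszul_def vu scaleR_right_distrib scaleR_sum_right
      by (intro arg_cong2[where f="(+)"] sum.cong refl) (simp_all add: 1 2 del: list.map)
  qed
  show ?thesis
  proof (intro ext)
    fix x vs
    show "ext_deriv X nab (rescale u \<omega>) x vs = rescale v (ext_deriv X nab \<omega>) x vs"
    proof (cases "\<exists>Vs. extends_to X x vs Vs")
      case True
      then have "extends_to X x vs (SOME Vs. extends_to X x vs Vs)" (is "extends_to X x vs ?Vs")
        by (rule someI_ex)
      then have "set ?Vs \<subseteq> vector_fields X" "length ?Vs = length vs"
        by (auto simp: extends_to_def dest: arg_cong[where f=length])
      then show ?thesis
        using True by (simp add: ext_deriv_def rescale_def[of v] key)
    next
      case False
      then show ?thesis
        unfolding ext_deriv_def rescale_def[of v] if_not_P[OF False] by simp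
    qed
  qed
qed

text \<open>
  A shuffle that feeds \<open>2i + 1\<close> of the arguments to \<open>H\<close> and the other \<open>p\<close> to \<open>\<omega>\<close> acquires the factor
  \<open>r\<^sup>i u p = u (p + 2i) = v (p + 2i + 1)\<close>, which depends only on the total number of
  arguments. Shuffles that feed an even number to \<open>H\<close> contribute nothing.
\<close>

lemma wedge_rescale:
  assumes H: "\<And>x vs. even (length vs) \<Longrightarrow> H x vs = 0"
    and u: "\<And>p. u (Suc (Suc p)) = r * u p" and v: "\<And>p. v (Suc p) = u p"
  shows "wedge (rescale (\<lambda>q. r ^ (q div 2)) H) (rescale u \<omega>) = rescale v (wedge H \<omega>)"
proof -
  have ui: "u (p + 2 * i) = r ^ i * u p" for p i
    by (induction i) (simp_all add: u)
  have "(shuffle_sign A * rescale (\<lambda>q. r ^ (q div 2)) H x (nths vs A)) *\<^sub>R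
          rescale u \<omega> x (nths vs (- A))
      = v (length vs) *\<^sub>R (shuffle_sign A * H x (nths vs A)) *\<^sub>R \<omega> x (nths vs (- A))" for A x vs
  proof (cases "even (length (nths vs A))")
    case True
    then show ?thesis by (simp add: rescale_def H)
  next
    case False
    then obtain i where i: "length (nths vs A) = 2 * i + 1" by (auto elim: oddE)
    have "length vs = Suc (length (nths vs (- A)) + 2 * i)"
      using length_nths_add_compl[of vs A] i by simp
    then have "v (length vs) = r ^ i * u (length (nths vs (- A)))"
      by (simp only: v ui)
    then show ?thesis using i by (simp add: rescale_def mult_ac)
  qed
  then show ?thesis
    by (simp add: wedge_def rescale_def[of v] scaleR_sum_right)
qed

lemma twisted_deriv_rescale:
  assumes "vector_bundle X E" "connection X E nab" "\<omega> \<in> parity_forms X E k"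
    and "\<And>x vs. even (length vs) \<Longrightarrow> H x vs = 0"
    and "\<And>p. u (Suc (Suc p)) = r * u p" "\<And>p. v (Suc p) = u p"
  shows "twisted_deriv X nab (rescale (\<lambda>q. r ^ (q div 2)) H) (rescale u \<omega>)
       = rescale v (twisted_deriv X nab H \<omega>)"
  using ext_deriv_rescale[OF assms(1-3), of v u, OF assms(6)]
    wedge_rescale[of H u r v, OF assms(4-6)]
  by (simp add: twisted_deriv_def rescale_add)

section \<open>The induced isomorphism\<close>

lemma rescale_image_plus: "rescale u ` (P + Q) = rescale u ` P + rescale u ` Q"
proof -
  have "P + Q = (\<lambda>(\<omega>, \<eta>). \<omega> + \<eta>) ` (P \<times> Q)" for P Q :: "('a, 'b) form set"
    by (auto simp: set_plus_def image_iff)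
  then show ?thesis
    by (force simp: image_image rescale_add case_prod_unfold)
qed

lemma rescale_image_elt_plus: "rescale u ` (\<omega> +o B) = rescale u \<omega> +o rescale u ` B"
proof -
  have "\<omega> +o B = (+) \<omega> ` B" for \<omega> and B :: "('a, 'b) form set"
    unfolding elt_set_plus_def by blast
  then show ?thesis by (simp add: image_image rescale_add)
qed

lemma rescale_image_coset_scale:
  assumes E: "vector_bundle X E"
  shows "rescale u ` coset_scale E B c P = coset_scale E (rescale u ` B) c (rescale u ` P)"
proof -
  interpret vector_space "scal E" using E by (simp add: vector_bundle_def)
  have of_real: "scal E (of_real a) w = a *\<^sub>R w" for a w
    using E by (simp add: vector_bundle_def)
  have "a *\<^sub>R scal E c w = scal E c (a *\<^sub>R w)" for a w
    using scale_left_commute[of "of_real a" c w] by (simp only: of_real)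
  then show ?thesis
    unfolding coset_scale_def rescale_image_plus image_image
    by (simp add: rescale_def)
qed

text \<open>
  An injective additive map that carries cocycles onto cocycles and coboundaries onto coboundaries
  carries cosets onto cosets, so the isomorphism of the quotients is the image map itself and no
  representatives need to be chosen.
\<close>

theorem twisted_cohomology_iso_rescale:
  fixes E :: "('a::{t2_space, second_countable_topology},
      'k::{real_normed_field, euclidean_space}, 'v::real_vector) vbundle"
  assumes X: "smooth_manifold X" and E: "vector_bundle X E" and nab: "connection X E nab"
    and H: "\<And>x vs. even (length vs) \<Longrightarrow> H x vs = 0" and r: "r \<noteq> 0"
  shows "twisted_cohomology_iso X E nab H (rescale (\<lambda>q. r ^ (q div 2)) H) k
           ((`) (rescale (\<lambda>q. r ^ (q div 2))))"
proof -
  \<comment> \<open>\<open>u 0\<close> induces the isomorphism; \<open>u 1\<close> is the weight one degree earlier that \<open>D\<close> carries to \<open>u 0\<close>.\<close>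
  define u where "u j q = r ^ ((q + j) div 2)" for j q
  have nz: "u j q \<noteq> 0" for j q using r by (simp add: u_def)
  let ?H' = "rescale (u 0) H"
  have H'_eq: "(\<lambda>q. r ^ (q div 2)) = u 0" by (simp add: u_def fun_eq_iff)
  \<comment> \<open>\<open>D\<close> carries \<open>u 0\<close> to the weight \<open>v\<close> one degree later; truncated subtraction makes \<open>v 0 = 1\<close>,
      so that \<open>v\<close>, like the other weights, never vanishes.\<close>
  define v where "v q = r ^ ((q - 1) div 2)" for q
  have v_nz: "v q \<noteq> 0" for q using r by (simp add: v_def)
  note par = rescale_image_parity_forms[OF X E nz]
  have D1: "twisted_deriv X nab ?H' (rescale (u 0) \<omega>) = rescale v (twisted_deriv X nab H \<omega>)"
    if "\<omega> \<in> parity_forms X E k" for \<omega>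
    unfolding H'_eq[symmetric]
    by (rule twisted_deriv_rescale[OF E nab that H]) (simp_all add: u_def v_def)
  have D2: "twisted_deriv X nab ?H' (rescale (u 1) \<omega>) = rescale (u 0) (twisted_deriv X nab H \<omega>)"
    if "\<omega> \<in> parity_forms X E (k + 1)" for \<omega>
    unfolding H'_eq[symmetric]
    by (rule twisted_deriv_rescale[OF E nab that H]) (simp_all add: u_def)
  have Z: "rescale (u 0) ` twisted_cocycles X E nab H k = twisted_cocycles X E nab ?H' k"
  proof -
    have "twisted_cocycles X E nab ?H' k
        = {\<eta> \<in> rescale (u 0) ` parity_forms X E k. twisted_deriv X nab ?H' \<eta> = 0}"
      by (simp add: twisted_cocycles_def par)
    also have "\<dots> = rescale (u 0) ` twisted_cocycles X E nab H k"
      unfolding Compr_image_eq twisted_cocycles_def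
      by (intro image_cong Collect_cong conj_cong refl)
        (simp add: D1 rescale_eq_0_iff v_nz)
    finally show ?thesis ..
  qed
  have B: "rescale (u 0) ` twisted_coboundaries X E nab H k = twisted_coboundaries X E nab ?H' k"
  proof -
    have "twisted_coboundaries X E nab ?H' k
        = twisted_deriv X nab ?H' ` rescale (u 1) ` parity_forms X E (k + 1)"
      by (simp only: twisted_coboundaries_def par)
    also have "\<dots> = rescale (u 0) ` twisted_coboundaries X E nab H k"
      unfolding twisted_coboundaries_def image_image using D2 by (intro image_cong refl) auto
    finally show ?thesis ..
  qed
  have "bij_betw ((`) (rescale (u 0))) (twisted_cohomology X E nab H k)
          (twisted_cohomology X E nab ?H' k)"
  proof (rule bij_betw_imageI)
    show "inj_on ((`) (rescale (u 0))) (twisted_cohomology X E nab H k)"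
      by (intro inj_onI) (simp only: inj_image_eq_iff[OF inj_rescale[of "u 0", OF nz]])
    show "(`) (rescale (u 0)) ` twisted_cohomology X E nab H k = twisted_cohomology X E nab ?H' k"
      unfolding twisted_cohomology_def Z[symmetric] image_image
      by (simp add: rescale_image_elt_plus B)
  qed
  then show ?thesis
    unfolding H'_eq twisted_cohomology_iso_def
    by (simp add: rescale_image_plus rescale_image_coset_scale[OF E] B)
qed

lemma sum_form_apply: "(\<Sum>i\<in>I. (f i :: ('a, 'v::comm_monoid_add) form)) x vs = (\<Sum>i\<in>I. f i x vs)"
  by (induction I rule: infinite_finite_induct) auto

theorem proposition1p1:
  fixes X :: "'a::{t2_space, second_countable_topology} manifold"
    and E :: "('a, 'k::{real_normed_field, euclidean_space}, 'v::real_vector) vbundle"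
    and nab :: "('a, 'v) conn"
    and H :: "('a, real) form"
    and Hs :: "nat \<Rightarrow> ('a, real) form"
    and r :: real
  assumes "oriented_manifold X"
    and "connected (UNIV :: 'a set)"
    and "compact (UNIV :: 'a set)"
    and "flat_bundle X E nab"
    and "H \<in> parity_forms X line_bundle 1"
    and "ext_deriv X trivial_conn H = 0"
    and "\<And>i. i \<ge> 1 \<Longrightarrow> Hs i \<in> forms X line_bundle (2 * i + 1)"
    and "H = (\<Sum>i = 1..mdim X. Hs i)"
    and "r \<noteq> 0"
  shows "twisted_cohomology_isomorphic X E nab H
           (\<Sum>i = 1..mdim X. (\<lambda>x vs. r ^ i * Hs i x vs))"
proof -
  have deg: "Hs i x vs = 0" if "i \<ge> 1" "length vs \<noteq> 2 * i + 1" for i x vs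
    using assms(7)[OF that(1)] that(2) by (simp add: forms_def)
  have H_even: "H x vs = 0" if "even (length vs)" for x vs
    unfolding assms(8) sum_form_apply using that by (intro sum.neutral ballI deg) auto
  \<comment> \<open>The summand \<open>Hs i\<close> is supported on lists of length \<open>2 * i + 1\<close>, where \<open>length vs div 2 = i\<close>.\<close>
  have "(\<Sum>i = 1..mdim X. (\<lambda>x vs. r ^ i * Hs i x vs)) = rescale (\<lambda>q. r ^ (q div 2)) H"
  proof (intro ext)
    fix x vs
    have "r ^ i * Hs i x vs = r ^ (length vs div 2) * Hs i x vs" if "i \<in> {1..mdim X}" for i
      using deg[of i vs x] that by (cases "length vs = 2 * i + 1") auto
    then show "(\<Sum>i = 1..mdim X. (\<lambda>x vs. r ^ i * Hs i x vs)) x vs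
        = rescale (\<lambda>q. r ^ (q div 2)) H x vs"
      unfolding assms(8) rescale_def sum_form_apply real_scaleR_def sum_distrib_left
      by (intro sum.cong refl)
  qed
  moreover have "smooth_manifold X" "vector_bundle X E" "connection X E nab"
    using assms(1,4) by (simp_all add: oriented_manifold_def flat_bundle_def)
  ultimately show ?thesis
    using twisted_cohomology_iso_rescale[of X E nab H r] H_even assms(9)
    unfolding twisted_cohomology_isomorphic_def by auto
qed

end
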